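(* Let $0\le m\le n$ be integers with $n\ge 1$, and let $\lambda_0,\ldots,\lambda_m\in\mathbb{C}$ be such that all the zeros of $\phi(z)=\sum_{i=0}^m\binom{n}{i}\lambda_i z^i$ lie in the half plane $|z|\le |z-\frac n2|$. Let $N$ be the associated operator on $\mathcal{P}_n$. If $P\in\mathcal{P}_n$ and $P(z)\neq 0$ in $|z|<1$, then $$|N[P](z)|\le \frac12\Big(|N[\psi_n](z)|+|\lambda_0|\Big)M\quad\text{for } |z|\ge 1,$$ where $M=\max_{|z|=1}|P(z)|$ and $\psi_n(z)=z^n$. The result is best possible: for $P(z)=az^n+b$ with $|a|=|b|\neq 0$, equality is attained in this inequality at some $z$ with $|z|\ge 1$.
   Context: $\mathcal{P}_n$ denotes the class of all polynomials with complex coefficients of degree at most $n$. For given $\lambda_0,\ldots,\lambda_m\in\mathbb{C}$ the operator $N:\mathcal{P}_n\to\mathcal{P}_n$ is defined by $$N[P](z)=\sum_{i=0}^{m}\lambda_i\left(\frac{nz}{2}\right)^i\frac{P^{(i)}(z)}{i!},$$ where $P^{(i)}$ is the $i$-th derivative of $P$. *)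

theory Defs
  imports "HOL-Analysis.Analysis" "HOL-Computational_Algebra.Polynomial"
begin

text \<open>The class of complex polynomials of degree at most \<open>n\<close>; the zero polynomial is included.\<close>

definition poly_class :: "nat \<Rightarrow> complex poly set" where
  "poly_class n = {P. degree P \<le> n}"

text \<open>Only the values \<open>lam 0, \<dots>, lam m\<close> of the sequence \<open>lam\<close> matter below.  The factor
  \<open>(n z / 2) ^ i\<close> is the polynomial \<open>monom ((n / 2) ^ i) i\<close> in \<open>z\<close>.\<close>

definition N_op :: "nat \<Rightarrow> nat \<Rightarrow> (nat \<Rightarrow> complex) \<Rightarrow> complex poly \<Rightarrow> complex poly" where
  "N_op n m lam P =
     (\<Sum>i\<le>m. smult (lam i / fact i) (monom ((of_nat n / 2) ^ i) i * (pderiv ^^ i) P))"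

lemma poly_N_op:
  "poly (N_op n m lam P) z =
     (\<Sum>i\<le>m. lam i * (of_nat n * z / 2) ^ i * (poly ((pderiv ^^ i) P) z / fact i))"
  unfolding N_op_def poly_sum
  by (intro sum.cong refl) (simp add: poly_monom power_mult_distrib power_divide mult_ac)

lemma N_op_in_poly_class:
  assumes "P \<in> poly_class n"
  shows "N_op n m lam P \<in> poly_class n"
proof -
  have deg: "degree ((pderiv ^^ i) P) = degree P - i" for i
    by (induction i) (simp_all add: degree_pderiv)
  have "degree (smult (lam i / fact i) (monom ((of_nat n / 2) ^ i) i * (pderiv ^^ i) P)) \<le> n" for i
  proof (cases "i \<le> degree P")
    case True
    have "degree (monom ((of_nat n / 2 :: complex) ^ i) i * (pderiv ^^ i) P) \<le> i + (degree P - i)"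
      using degree_mult_le[of "monom ((of_nat n / 2 :: complex) ^ i) i" "(pderiv ^^ i) P"]
        degree_monom_le[of "(of_nat n / 2 :: complex) ^ i" i] deg[of i] by linarith
    then show ?thesis
      using True assms by (auto simp: poly_class_def)
  next
    case False
    then obtain j where j: "i = Suc j" "degree P \<le> j"
      by (cases i) auto
    have "degree ((pderiv ^^ j) P) = 0"
      using deg[of j] j by simp
    then have "(pderiv ^^ i) P = 0"
      using j by (simp add: pderiv_eq_0_iff)
    then show ?thesis by simp
  qed
  then show ?thesis
    unfolding N_op_def poly_class_def by (auto intro!: degree_sum_le)
qed

definition phi_poly :: "nat \<Rightarrow> nat \<Rightarrow> (nat \<Rightarrow> complex) \<Rightarrow> complex poly" where
  "phi_poly n m lam = (\<Sum>i\<le>m. monom (of_nat (n choose i) * lam i) i)"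

text \<open>The supremum over the unit circle is attained, so it is the maximum.\<close>

definition circle_max :: "complex poly \<Rightarrow> real" where
  "circle_max P = (SUP z\<in>sphere 0 1. cmod (poly P z))"

lemma circle_max_attained:
  shows "\<exists>z. cmod z = 1 \<and> cmod (poly P z) = circle_max P"
    and "cmod z = 1 \<Longrightarrow> cmod (poly P z) \<le> circle_max P"
proof -
  have "continuous_on (sphere 0 1) (\<lambda>z. cmod (poly P z))"
    by (intro continuous_intros)
  then obtain w where w: "w \<in> sphere 0 1"
      "\<And>z. z \<in> sphere 0 1 \<Longrightarrow> cmod (poly P z) \<le> cmod (poly P w)"
    using continuous_attains_sup[of "sphere (0::complex) 1" "\<lambda>z. cmod (poly P z)"]
    by (auto simp: sphere_eq_empty)
  then have eq: "circle_max P = cmod (poly P w)"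
    unfolding circle_max_def by (intro cSup_eq_maximum) auto
  show "\<exists>z. cmod z = 1 \<and> cmod (poly P z) = circle_max P"
    using w eq by auto
  show "cmod z = 1 \<Longrightarrow> cmod (poly P z) \<le> circle_max P"
    using w eq by auto
qed

end

theory Submission
  imports Defs "HOL-Complex_Analysis.Conformal_Mappings"
    "HOL-Computational_Algebra.Fundamental_Theorem_Algebra"
begin

text \<open>The operator \<open>N\<close> is a disguised iteration of polar derivatives.  At a fixed point \<open>z\<close>, up to the
factor \<open>n!\<close>, the value \<open>N[H](z)\<close> pairs \<open>H\<close> with the polynomial \<open>\<phi>\<close>, and splitting off a linear
factor of \<open>\<phi>\<close> with root \<open>a\<close> amounts to replacing \<open>H\<close> by its polar derivative with respect to the
point \<open>z (1 - n / (2 a))\<close> (lemma \<open>polar_pairing_root\<close>).  The hypothesis on the zeros of \<open>\<phi>\<close> says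
exactly that this point has modulus at least \<open>\<bar>z\<bar>\<close>.  By Laguerre's theorem (\<open>laguerre_disc\<close>) a polar
derivative with pole outside the closed unit disc keeps all zeros inside that disc, so after as many
steps as \<open>\<phi>\<close> has roots one is left with the value at \<open>z\<close> of a polynomial without zeros outside the
disc.  Hence \<open>N[H](z) \<noteq> 0\<close> for \<open>\<bar>z\<bar> > 1\<close> whenever \<open>H\<close> has exact degree \<open>n\<close> and all its zeros in the
closed disc (\<open>N_op_nonzero_outside\<close>).

This non-vanishing becomes an inequality by linearity.  Write
\<open>F\<^sup>*(x) = x\<^sup>n cnj (F (1 / cnj x))\<close>.  If \<open>F\<close> has no zeros in the open disc, then
\<open>\<bar>F\<^sup>*\<bar> \<le> \<bar>F\<bar>\<close> there, so \<open>F - cnj b F\<^sup>*\<close> has no zeros there either when \<open>\<bar>b\<bar> < 1\<close>.  Therefore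
\<open>N[F\<^sup>*](z) \<noteq> b N[F](z)\<close> for all such \<open>b\<close>, that is \<open>\<bar>N[F](z)\<bar> \<le> \<bar>N[F\<^sup>*](z)\<bar>\<close> (\<open>N_op_le_conj_recip\<close>).

The comparison is used twice.  For \<open>F = P\<close> it gives \<open>\<bar>N[P]\<bar> \<le> \<bar>N[P\<^sup>*]\<bar>\<close>.  For
\<open>F = P + c M\<close> with \<open>\<bar>c\<bar> > 1\<close> and \<open>c\<close> of the right argument it gives, as \<open>\<bar>c\<bar> \<rightarrow> 1\<close>, the inequality
\<open>\<bar>N[P]\<bar> + \<bar>N[P\<^sup>*]\<bar> \<le> (\<bar>N[\<psi>]\<bar> + \<bar>\<lambda>\<^sub>0\<bar>) M\<close> with \<open>\<psi>(z) = z\<^sup>n\<close> (\<open>N_op_add_conj_recip_le\<close>).  Adding the two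
proves the bound for \<open>\<bar>z\<bar> > 1\<close>, and continuity extends it to the unit circle.  For sharpness,
\<open>N[a z\<^sup>n + b] = a \<phi>(n/2) z\<^sup>n + b \<lambda>\<^sub>0\<close>, and on the unit circle the two summands can be given the same
argument.\<close>

section \<open>Induction on linear factors and reflection in the unit circle\<close>

text \<open>The formal degree \<open>k\<close> is only an upper bound for the degree and drops by one with each linear factor;
missing roots, which in the projective picture lie at infinity, are absorbed into the constant case.\<close>

lemma complex_poly_root_induct [consumes 1, case_names const root]:
  fixes P :: "complex poly"
  assumes "degree P \<le> k"
    and const: "\<And>c k. Q [:c:] k"
    and root: "\<And>a P k. degree P \<le> k \<Longrightarrow> Q P k \<Longrightarrow> Q ([:a, -1:] * P) (Suc k)"
  shows "Q P k"
  using assms(1)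
proof (induction P arbitrary: k rule: poly_root_induct[where P = "\<lambda>_. True"])
  case 0
  show ?case using const[of 0 k] by simp
next
  case (no_roots P)
  then have "constant (poly P)"
    using fundamental_theorem_of_algebra by blast
  then obtain c where "P = [:c:]"
    by (metis constant_degree degree_eq_zeroE)
  then show ?case using const by simp
next
  case (root a P)
  show ?case
  proof (cases "P = 0")
    case True
    then show ?thesis using const[of 0 k] by simp
  next
    case False
    then have "degree ([:a, -1:] * P) = Suc (degree P)"
      by (subst degree_mult_eq) auto
    with root.prems obtain j where "k = Suc j" "degree P \<le> j"
      by (cases k) auto
    then show ?thesis using root.IH assms(3) by simp
  qed
qed

text \<open>The Blaschke factor \<open>(x - a) / (1 - cnj x a)\<close> compares the distance of \<open>a\<close> from \<open>x\<close> with that from the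
mirror image of \<open>x\<close>; which of the two is larger depends only on the sides of the unit circle on which
\<open>x\<close> and \<open>a\<close> lie.\<close>

lemma reflection_identity:
  "(cmod (x - a))\<^sup>2 - (cmod (1 - cnj x * a))\<^sup>2 = (1 - (cmod x)\<^sup>2) * ((cmod a)\<^sup>2 - 1)"
  unfolding cmod_power2 by (simp add: power2_eq_square algebra_simps)

lemma reflection_le:
  assumes "cmod x \<le> 1" "1 \<le> cmod a"
  shows "cmod (1 - cnj x * a) \<le> cmod (x - a)"
proof -
  have "0 \<le> (1 - (cmod x)\<^sup>2) * ((cmod a)\<^sup>2 - 1)"
    using assms by (simp add: abs_square_le_1 power_le_one)
  then have "(cmod (1 - cnj x * a))\<^sup>2 \<le> (cmod (x - a))\<^sup>2"
    using reflection_identity[of x a] by linarith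
  then show ?thesis by (rule power2_le_imp_le) simp
qed

lemma reflection_gt:
  assumes "cmod x < 1" "cmod a < 1"
  shows "cmod (x - a) < cmod (1 - cnj x * a)"
proof -
  have "(1 - (cmod x)\<^sup>2) * ((cmod a)\<^sup>2 - 1) < 0"
    using assms by (simp add: mult_less_0_iff abs_square_less_1)
  then have "(cmod (x - a))\<^sup>2 < (cmod (1 - cnj x * a))\<^sup>2"
    using reflection_identity[of x a] by linarith
  then show ?thesis by (rule power2_less_imp_less) simp
qed

definition disc_zero_free :: "complex poly \<Rightarrow> bool" where
  "disc_zero_free P \<longleftrightarrow> (\<forall>z. cmod z < 1 \<longrightarrow> poly P z \<noteq> 0)"

lemma disc_zero_free_root:
  assumes "disc_zero_free ([:a, -1:] * P)"
  shows "1 \<le> cmod a" "disc_zero_free P"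
  using assms linorder_not_le by (auto simp: disc_zero_free_def)

section \<open>Conjugate reciprocal polynomials\<close>

text \<open>This is \<open>x\<^sup>n cnj (P (1 / cnj x))\<close> when \<open>degree P \<le> n\<close>.  Reversal relative to a formal degree \<open>n\<close>, and
not to the actual degree, makes the operation additive, and it lets
\<open>disc_zero_free (conj_recip n P)\<close> express in one condition that \<open>P\<close> has exact degree \<open>n\<close> (look at the
point \<open>0\<close>) and all its zeros in the closed unit disc.\<close>

definition conj_recip :: "nat \<Rightarrow> complex poly \<Rightarrow> complex poly" where
  "conj_recip n P = (\<Sum>i\<le>n. monom (cnj (coeff P i)) (n - i))"

lemma coeff_conj_recip:
  "coeff (conj_recip n P) j = (if j \<le> n then cnj (coeff P (n - j)) else 0)"
proof -
  have "coeff (conj_recip n P) j = (\<Sum>i\<le>n. if n - i = j then cnj (coeff P i) else 0)"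
    by (simp add: conj_recip_def coeff_sum)
  also have "\<dots> = (\<Sum>i\<in>{i. i \<le> n \<and> n - i = j}. cnj (coeff P i))"
    by (rule sum.mono_neutral_cong_right) auto
  also have "{i. i \<le> n \<and> n - i = j} = (if j \<le> n then {n - j} else {})"
    by auto
  finally show ?thesis by simp
qed

lemma degree_conj_recip: "degree (conj_recip n P) \<le> n"
  by (rule degree_le) (simp add: coeff_conj_recip)

lemma conj_recip_add: "conj_recip n (P + Q) = conj_recip n P + conj_recip n Q"
  and conj_recip_diff: "conj_recip n (P - Q) = conj_recip n P - conj_recip n Q"
  and conj_recip_smult: "conj_recip n (smult c P) = smult (cnj c) (conj_recip n P)"
  and conj_recip_const: "conj_recip n [:c:] = monom (cnj c) n"
  by (auto intro!: poly_eqI simp: coeff_conj_recip coeff_pCons split: nat.splits)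

lemma conj_recip_conj_recip:
  assumes "degree P \<le> n"
  shows "conj_recip n (conj_recip n P) = P"
  using assms by (auto intro!: poly_eqI simp: coeff_conj_recip coeff_eq_0)

lemma coeff_linear_mult:
  "coeff ([:u, a:] * P) i = u * coeff P i + a * (case i of 0 \<Rightarrow> 0 | Suc j \<Rightarrow> coeff P j)"
  by (simp add: coeff_pCons split: nat.splits)

lemma coeff_linear_mult_pderiv:
  "coeff ([:u, a:] * pderiv P) i = u * of_nat (Suc i) * coeff P (Suc i) + a * of_nat i * coeff P i"
  unfolding coeff_linear_mult by (cases i) (simp_all add: coeff_pderiv mult_ac)

lemma conj_recip_root:
  assumes "degree P \<le> n"
  shows "conj_recip (Suc n) ([:a, -1:] * P) = [:-1, cnj a:] * conj_recip n P"
proof (rule poly_eqI)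
  fix j
  have "j = 0 \<or> (\<exists>i. j = Suc i \<and> i < n) \<or> j = Suc n \<or> Suc n < j"
    by (cases j) auto
  then consider "j = 0" | i where "j = Suc i" "i < n" | "j = Suc n" | "Suc n < j"
    by blast
  then show "coeff (conj_recip (Suc n) ([:a, -1:] * P)) j
               = coeff ([:-1, cnj a:] * conj_recip n P) j"
  proof cases
    case 2
    then have "Suc n - j = Suc (n - j)" by simp
    with 2 show ?thesis
      unfolding coeff_linear_mult by (simp add: coeff_conj_recip coeff_linear_mult del: mult_pCons_left)
  qed (unfold coeff_linear_mult, use assms in \<open>auto simp: coeff_conj_recip coeff_eq_0 split: nat.splits\<close>)
qed

lemma poly_conj_recip:
  assumes "degree P \<le> n" "x \<noteq> 0"
  shows "poly (conj_recip n P) x = x ^ n * cnj (poly P (inverse (cnj x)))"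
proof -
  have "P = (\<Sum>i\<le>n. monom (coeff P i) i)"
    using poly_as_sum_of_monoms'[OF assms(1)] by simp
  then have "poly P (inverse (cnj x)) = (\<Sum>i\<le>n. coeff P i * inverse (cnj x) ^ i)"
    by (metis (no_types, lifting) poly_monom poly_sum sum.cong)
  then have "x ^ n * cnj (poly P (inverse (cnj x))) = (\<Sum>i\<le>n. cnj (coeff P i) * (x ^ n * inverse x ^ i))"
    by (simp add: sum_distrib_left mult_ac)
  also have "\<dots> = (\<Sum>i\<le>n. cnj (coeff P i) * x ^ (n - i))"
    using assms(2) by (intro sum.cong refl) (simp add: power_diff field_simps)
  also have "\<dots> = poly (conj_recip n P) x"
    by (simp add: conj_recip_def poly_sum poly_monom)
  finally show ?thesis by simp
qed

text \<open>Linear factor by linear factor this is \<open>reflection_le\<close>: each factor \<open>a - x\<close> of \<open>P\<close> with \<open>\<bar>a\<bar> \<ge> 1\<close> turns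
into a factor of modulus \<open>\<bar>1 - cnj x a\<bar>\<close>.\<close>

lemma norm_conj_recip_le:
  assumes "degree P \<le> n" "disc_zero_free P" "cmod x < 1"
  shows "cmod (poly (conj_recip n P) x) \<le> cmod (poly P x)"
  using assms(1,2)
proof (induction P n rule: complex_poly_root_induct)
  case (const c k)
  show ?case
    using assms(3) by (simp add: conj_recip_const poly_monom norm_mult norm_power mult_left_le power_le_one)
next
  case (root a P k)
  note free = disc_zero_free_root[OF root.prems]
  have "poly [:-1, cnj a:] x = - cnj (1 - cnj x * a)"
    by (simp add: mult.commute)
  then have "cmod (poly [:-1, cnj a:] x) = cmod (1 - cnj x * a)"
    by (simp only: norm_minus_cancel complex_mod_cnj)
  also have "\<dots> \<le> cmod (poly [:a, -1:] x)"
    using reflection_le[of x a] assms(3) free(1) by (simp add: norm_minus_commute)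
  finally show ?case
    using root.IH[OF free(2)] root.hyps
    by (simp only: conj_recip_root poly_mult norm_mult) (intro mult_mono, auto)
qed

section \<open>Laguerre's theorem for the unit disc\<close>

text \<open>If \<open>\<bar>x\<bar> < 1\<close>, the numbers \<open>1 / (x - a)\<close> with \<open>\<bar>a\<bar> \<ge> 1\<close> (or \<open>a = \<infinity>\<close>) fill the closed disc with centre
\<open>- cnj x / (1 - \<bar>x\<bar>\<^sup>2)\<close> and radius \<open>1 / (1 - \<bar>x\<bar>\<^sup>2)\<close>.  The logarithmic derivative \<open>P' / P\<close> is a sum of
\<open>k\<close> such numbers, so by convexity it lies in the disc enlarged \<open>k\<close> times; this is the assertion with
denominators cleared.\<close>

lemma disc_derivative_bound:
  assumes "degree P \<le> k" "disc_zero_free P" "cmod x < 1"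
  shows "cmod ((1 - x * cnj x) * poly (pderiv P) x + of_nat k * cnj x * poly P x)
           \<le> of_nat k * cmod (poly P x)"
  using assms(1,2)
proof (induction P k rule: complex_poly_root_induct)
  case (const c k)
  show ?case
    using assms(3) by (simp add: pderiv_pCons norm_mult mult_left_le_one_le mult_left_le mult_mono')
next
  case (root a P k)
  note free = disc_zero_free_root[OF root.prems]
  define D where "D = (1 - x * cnj x) * poly (pderiv P) x + of_nat k * cnj x * poly P x"
  have pd: "pderiv ([:a, -1:] * P) = [:a, -1:] * pderiv P - P"
    unfolding pderiv_mult by (simp add: pderiv_pCons algebra_simps)
  have "(1 - x * cnj x) * poly (pderiv ([:a, -1:] * P)) x
          + of_nat (Suc k) * cnj x * poly ([:a, -1:] * P) x
        = (a - x) * D - (1 - cnj x * a) * poly P x"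
    unfolding pd by (simp add: D_def algebra_simps)
  also have "cmod \<dots> \<le> cmod (a - x) * cmod D + cmod (1 - cnj x * a) * cmod (poly P x)"
    by (metis norm_mult norm_triangle_ineq4)
  also have "\<dots> \<le> cmod (a - x) * (of_nat k * cmod (poly P x)) + cmod (a - x) * cmod (poly P x)"
    using root.IH[OF free(2)] reflection_le[of x a] assms(3) free(1)
    by (intro add_mono mult_left_mono mult_right_mono) (auto simp: D_def norm_minus_commute)
  also have "\<dots> = of_nat (Suc k) * cmod (poly ([:a, -1:] * P) x)"
    unfolding poly_mult norm_mult by (simp add: distrib_right)
  finally show ?case .
qed

text \<open>With \<open>w = - a / u\<close>, a point of the open unit disc, the polynomial is
\<open>u ((k + 1) G + (w - x) G')\<close>, a multiple of the polar derivative of \<open>G\<close> with respect to \<open>w\<close>.  At a zero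
of it, \<open>G' / G\<close> would be \<open>(k + 1) / (x - w)\<close>, which is outside the disc of
\<open>disc_derivative_bound\<close> because \<open>w\<close> is inside the unit disc (\<open>reflection_gt\<close>).\<close>

lemma laguerre_disc:
  assumes "degree G \<le> Suc k" "disc_zero_free G" "cmod a < cmod u"
  shows "disc_zero_free (smult (u * of_nat (Suc k)) G - [:a, u:] * pderiv G)"
  unfolding disc_zero_free_def
proof (intro allI impI notI)
  fix x assume x: "cmod x < 1"
  define w where "w = - a / u"
  have u: "u \<noteq> 0" using assms(3) by auto
  have w: "cmod w < 1" using assms(3) u by (simp add: w_def norm_divide)
  have a: "a = - u * w" using u by (simp add: w_def)
  assume "poly (smult (u * of_nat (Suc k)) G - [:a, u:] * pderiv G) x = 0"
  then have "u * (of_nat (Suc k) * poly G x - (x - w) * poly (pderiv G) x) = 0"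
    by (simp add: a algebra_simps)
  then have eq: "(x - w) * poly (pderiv G) x = of_nat (Suc k) * poly G x"
    using u by simp
  let ?D = "(1 - x * cnj x) * poly (pderiv G) x + of_nat (Suc k) * cnj x * poly G x"
  have "(x - w) * ?D = (1 - x * cnj x) * ((x - w) * poly (pderiv G) x)
          + of_nat (Suc k) * cnj x * (x - w) * poly G x"
    by (simp only: algebra_simps)
  also have "\<dots> = of_nat (Suc k) * poly G x * (1 - cnj x * w)"
    unfolding eq by (simp only: algebra_simps)
  finally have "cmod (x - w) * cmod ?D = of_nat (Suc k) * cmod (poly G x) * cmod (1 - cnj x * w)"
    by (metis norm_mult norm_of_nat)
  moreover have "cmod (x - w) * cmod ?D \<le> cmod (x - w) * (of_nat (Suc k) * cmod (poly G x))"
    using disc_derivative_bound[OF assms(1,2) x] by (rule mult_left_mono) simp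
  moreover have "0 < of_nat (Suc k) * cmod (poly G x)"
    using assms(2) x by (auto simp: disc_zero_free_def)
  moreover note reflection_gt[OF x w]
  ultimately show False
    by (smt (verit, best) mult.commute mult_strict_left_mono)
qed

section \<open>Pairing with a polynomial by repeated polar derivatives\<close>

text \<open>Conjugate reciprocals turn the polar derivative with pole \<open>- u / a\<close> into the one whose pole is the
reflection \<open>- cnj a / cnj u\<close> of that point in the unit circle.  In this way Laguerre's theorem inside the
disc also controls polynomials whose zeros lie inside the disc and whose pole lies outside.  Using the
coefficients \<open>u\<close> and \<open>a\<close> rather than their quotient includes the pole at infinity, \<open>a = 0\<close>.\<close>

lemma conj_recip_polar:
  assumes "degree H \<le> Suc k"
  shows "conj_recip k (smult (a * of_nat (Suc k)) H - [:u, a:] * pderiv H)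
           = - (smult (cnj u * of_nat (Suc k)) (conj_recip (Suc k) H)
                  - [:cnj a, cnj u:] * pderiv (conj_recip (Suc k) H))" (is "?L = ?R")
proof (rule poly_eqI)
  fix j
  show "coeff ?L j = coeff ?R j"
  proof (cases "j \<le> k")
    case True
    have split: "of_nat (k - j) = (of_nat k - of_nat j :: complex)" "Suc (k - j) = Suc k - j" "k - j \<le> Suc k"
      using True by (simp_all add: of_nat_diff Suc_diff_le)
    have "coeff ?L j = cnj (a * of_nat (Suc k) * coeff H (k - j)
        - (u * (of_nat k - of_nat j + 1) * coeff H (Suc k - j) + a * (of_nat k - of_nat j) * coeff H (k - j)))"
      using True split(2)
      by (simp only: coeff_conj_recip coeff_diff coeff_smult coeff_linear_mult_pderiv if_True
            of_nat_Suc[of "k - j"] split(1)) (simp add: add.commute)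
    also have "\<dots> = coeff ?R j"
      using True
      by (simp only: coeff_minus coeff_diff coeff_smult coeff_linear_mult_pderiv coeff_conj_recip)
        (simp add: algebra_simps)
    finally show ?thesis .
  next
    case False
    then show ?thesis
      by (cases "j = Suc k")
        (simp_all only: coeff_minus coeff_diff coeff_smult coeff_linear_mult_pderiv coeff_conj_recip,
         simp_all)
  qed
qed

lemma degree_polar:
  assumes "degree H \<le> Suc k"
  shows "degree (smult (a * of_nat (Suc k)) H - [:u, a:] * pderiv H) \<le> k"
proof (rule degree_le, intro allI impI)
  fix i assume "k < i"
  show "coeff (smult (a * of_nat (Suc k)) H - [:u, a:] * pderiv H) i = 0"
    using \<open>k < i\<close> assms
    unfolding coeff_diff coeff_smult coeff_linear_mult_pderiv
    by (cases "i = Suc k") (simp_all add: coeff_eq_0)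
qed

lemma higher_pderiv_polar:
  fixes H :: "complex poly"
  shows
  "poly ((pderiv ^^ i) (smult c H - [:u, a:] * pderiv H)) z
     = (c - of_nat i * a) * poly ((pderiv ^^ i) H) z
       - (u + a * z) * poly ((pderiv ^^ Suc i) H) z"
proof -
  have "(pderiv ^^ i) (smult c H - [:u, a:] * pderiv H)
      = smult (c - of_nat i * a) ((pderiv ^^ i) H) - [:u, a:] * (pderiv ^^ Suc i) H"
  proof (induction i)
    case (Suc i)
    let ?R = "(pderiv ^^ Suc i) H"
    have "pderiv (smult (c - of_nat i * a) ((pderiv ^^ i) H) - [:u, a:] * ?R)
        = smult (c - of_nat i * a) ?R - ([:u, a:] * pderiv ?R + smult a ?R)"
      by (simp only: pderiv_diff pderiv_mult pderiv_smult) (simp add: pderiv_pCons)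
    also have "\<dots> = smult (c - of_nat (Suc i) * a) ?R - [:u, a:] * pderiv ?R"
      by (simp add: smult_diff_left smult_add_left distrib_right)
    finally show ?case
      using Suc.IH by simp
  qed simp
  then show ?thesis
    by (simp only: poly_diff poly_smult poly_mult) (simp add: algebra_simps)
qed

text \<open>For \<open>s = n z / 2\<close> and \<open>p = \<phi>\<close> this is \<open>n! N[H](z)\<close>.  The weights \<open>(k - i)!\<close> are those for which
multiplication of \<open>p\<close> by a linear factor becomes a polar derivative of \<open>H\<close>.\<close>

definition polar_pairing ::
    "nat \<Rightarrow> complex \<Rightarrow> complex \<Rightarrow> complex poly \<Rightarrow> complex poly \<Rightarrow> complex" where
  "polar_pairing k s z p H =
     (\<Sum>i\<le>k. coeff p i * fact (k - i) * s ^ i * poly ((pderiv ^^ i) H) z)"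

lemma polar_pairing_root:
  assumes "degree p \<le> k"
  shows "polar_pairing (Suc k) s z ([:a, -1:] * p) H
           = polar_pairing k s z p (smult (a * of_nat (Suc k)) H - [:s - a * z, a:] * pderiv H)"
proof -
  let ?h = "\<lambda>i. poly ((pderiv ^^ i) H) z"
  have coeff: "coeff ([:a, -1:] * p) i = a * coeff p i - (case i of 0 \<Rightarrow> 0 | Suc j \<Rightarrow> coeff p j)" for i
    by (simp add: coeff_pCons split: nat.splits)
  have "polar_pairing (Suc k) s z ([:a, -1:] * p) H
      = (\<Sum>i\<le>Suc k. a * coeff p i * fact (Suc k - i) * s ^ i * ?h i)
        - (\<Sum>i\<le>Suc k. (case i of 0 \<Rightarrow> 0 | Suc j \<Rightarrow> coeff p j) * fact (Suc k - i) * s ^ i * ?h i)"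
    unfolding polar_pairing_def coeff by (simp only: left_diff_distrib sum_subtractf)
  also have "(\<Sum>i\<le>Suc k. a * coeff p i * fact (Suc k - i) * s ^ i * ?h i)
      = (\<Sum>i\<le>k. a * coeff p i * fact (Suc k - i) * s ^ i * ?h i)"
    using assms by (simp add: coeff_eq_0)
  also have "(\<Sum>i\<le>Suc k. (case i of 0 \<Rightarrow> 0 | Suc j \<Rightarrow> coeff p j) * fact (Suc k - i) * s ^ i * ?h i)
      = (\<Sum>i\<le>k. coeff p i * fact (k - i) * s ^ Suc i * ?h (Suc i))"
    by (subst sum.atMost_Suc_shift) simp
  also have "(\<Sum>i\<le>k. a * coeff p i * fact (Suc k - i) * s ^ i * ?h i) - \<dots>
      = (\<Sum>i\<le>k. coeff p i * fact (k - i) * s ^ i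
           * ((a * of_nat (Suc k) - of_nat i * a) * ?h i - s * ?h (Suc i)))"
    unfolding sum_subtractf[symmetric]
  proof (rule sum.cong)
    fix i assume "i \<in> {..k}"
    then have fact: "fact (Suc k - i) = (of_nat (Suc k) - of_nat i) * (fact (k - i) :: complex)"
      by (simp add: Suc_diff_le of_nat_diff)
    \<comment> \<open>The factor \<open>k + 1 - i\<close> split off the factorial is the one that the \<open>i\<close>-th derivative of the
      polar derivative produces.\<close>
    show "a * coeff p i * fact (Suc k - i) * s ^ i * ?h i
                 - coeff p i * fact (k - i) * s ^ Suc i * ?h (Suc i)
             = coeff p i * fact (k - i) * s ^ i
                 * ((a * of_nat (Suc k) - of_nat i * a) * ?h i - s * ?h (Suc i))"
      unfolding fact power_Suc by (simp only: algebra_simps)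
  qed simp
  finally show ?thesis
    unfolding polar_pairing_def higher_pderiv_polar by simp
qed

text \<open>Each root \<open>a\<close> of \<open>p\<close> contributes a polar derivative with pole \<open>z - s / a\<close>, and the assumption on \<open>a\<close>
places that pole outside the closed unit disc.  Laguerre's theorem preserves the condition on \<open>H\<close>, and
when the roots are used up what remains is a nonzero multiple of the value at \<open>z\<close> of a polynomial
with all its zeros in the closed disc.\<close>

lemma polar_pairing_nonzero:
  assumes "degree p \<le> k" "p \<noteq> 0" "\<And>a. poly p a = 0 \<Longrightarrow> cmod a < cmod (s - a * z)"
    and "1 < cmod z" "degree H \<le> k" "disc_zero_free (conj_recip k H)"
  shows "polar_pairing k s z p H \<noteq> 0"
  using assms(1,2,3,5,6)
proof (induction p k arbitrary: H rule: complex_poly_root_induct)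
  case (const c k)
  have z: "z \<noteq> 0" "cmod (inverse (cnj z)) < 1"
    using assms(4) by (auto simp: norm_inverse inverse_less_1_iff)
  have "poly (conj_recip k H) (inverse (cnj z)) \<noteq> 0"
    using const.prems(4) z(2) by (simp add: disc_zero_free_def)
  then have "poly H z \<noteq> 0"
    using poly_conj_recip[OF const.prems(3), of "inverse (cnj z)"] z(1) by auto
  moreover have "polar_pairing k s z [:c:] H = (\<Sum>i\<le>k. if i = 0 then c * fact k * poly H z else 0)"
    unfolding polar_pairing_def by (rule sum.cong) (auto simp: coeff_pCons split: nat.splits)
  ultimately show ?case
    using const.prems(1) by simp
next
  case (root a p k)
  let ?u = "s - a * z"
  let ?Q = "smult (a * of_nat (Suc k)) H - [:?u, a:] * pderiv H"
  have "cmod (cnj a) < cmod (cnj ?u)"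
    unfolding complex_mod_cnj using root.prems(2)[of a] by simp
  with laguerre_disc[OF degree_conj_recip root.prems(4)]
  have "disc_zero_free (conj_recip k ?Q)"
    unfolding conj_recip_polar[OF root.prems(3)] disc_zero_free_def poly_minus neg_equal_0_iff_equal
    by blast
  moreover have "degree ?Q \<le> k"
    using degree_polar[OF root.prems(3)] .
  ultimately have "polar_pairing k s z p ?Q \<noteq> 0"
  proof (intro root.IH)
    show "p \<noteq> 0" using root.prems(1) by auto
    show "cmod b < cmod (s - b * z)" if "poly p b = 0" for b
      using root.prems(2)[of b] that by simp
  qed
  then show ?case
    using polar_pairing_root[OF root.hyps] by simp
qed

section \<open>The operator at points outside the unit disc\<close>

lemma norm_le_circle_max_disc:
  assumes "cmod x \<le> 1"
  shows "cmod (poly P x) \<le> circle_max P"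
proof (rule maximum_modulus_frontier[where S = "cball 0 1" and f = "poly P"])
  show "cmod (poly P w) \<le> circle_max P" if "w \<in> frontier (cball 0 1)" for w
    using that circle_max_attained(2)[of w P] by simp
qed (use assms in \<open>auto intro!: holomorphic_intros continuous_intros\<close>)

context
  fixes n m :: nat and lam :: "nat \<Rightarrow> complex"
begin

lemma coeff_phi_poly: "coeff (phi_poly n m lam) i = (if i \<le> m then of_nat (n choose i) * lam i else 0)"
  by (simp add: phi_poly_def coeff_sum)

lemma degree_phi_poly: "degree (phi_poly n m lam) \<le> m"
  by (rule degree_le) (simp add: coeff_phi_poly)

lemma N_op_add: "N_op n m lam (P + Q) = N_op n m lam P + N_op n m lam Q"
  and N_op_diff: "N_op n m lam (P - Q) = N_op n m lam P - N_op n m lam Q"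
  and N_op_smult: "N_op n m lam (smult c P) = smult c (N_op n m lam P)"
proof -
  have diff: "(pderiv ^^ i) (P - Q) = (pderiv ^^ i) P - (pderiv ^^ i) Q" for i
    by (induction i) (simp_all add: pderiv_diff)
  show "N_op n m lam (P + Q) = N_op n m lam P + N_op n m lam Q"
    by (simp add: N_op_def higher_pderiv_add distrib_left smult_add_right sum.distrib)
  show "N_op n m lam (P - Q) = N_op n m lam P - N_op n m lam Q"
    by (simp add: N_op_def diff right_diff_distrib smult_diff_right sum_subtractf)
  show "N_op n m lam (smult c P) = smult c (N_op n m lam P)"
    by (rule poly_eqI) (simp add: N_op_def higher_pderiv_smult coeff_sum sum_distrib_left mult_ac)
qed

lemma poly_N_op_const: "poly (N_op n m lam [:c:]) z = lam 0 * c"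
proof -
  have "(pderiv ^^ i) [:c:] = (if i = 0 then [:c:] else 0)" for i
    by (cases i) (simp_all add: funpow_Suc_right pderiv_pCons del: funpow.simps)
  then have "poly (N_op n m lam [:c:]) z = (\<Sum>i\<le>m. if i = 0 then lam 0 * c else 0)"
    unfolding poly_N_op by (intro sum.cong) auto
  then show ?thesis by simp
qed

lemma poly_N_op_eq_polar_pairing:
  assumes "m \<le> n"
  shows "fact n * poly (N_op n m lam P) z = polar_pairing n (of_nat n * z / 2) z (phi_poly n m lam) P"
proof -
  have "polar_pairing n (of_nat n * z / 2) z (phi_poly n m lam) P
      = (\<Sum>i\<le>m. of_nat (n choose i) * lam i * fact (n - i) * (of_nat n * z / 2) ^ i
          * poly ((pderiv ^^ i) P) z)"
    unfolding polar_pairing_def using assms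
    by (intro sum.mono_neutral_cong_right) (auto simp: coeff_phi_poly)
  also have "\<dots> = fact n * poly (N_op n m lam P) z"
    unfolding poly_N_op sum_distrib_left
  proof (rule sum.cong)
    fix i assume "i \<in> {..m}"
    then have "of_nat (n choose i) * fact (n - i) = (fact n / fact i :: complex)"
      using assms by (simp add: binomial_fact)
    then show "of_nat (n choose i) * lam i * fact (n - i) * (of_nat n * z / 2) ^ i * poly ((pderiv ^^ i) P) z
        = fact n * (lam i * (of_nat n * z / 2) ^ i * (poly ((pderiv ^^ i) P) z / fact i))"
      by (simp add: field_simps)
  qed simp
  finally show ?thesis by simp
qed

lemma poly_N_op_power:
  shows "poly (N_op n m lam (monom 1 n)) z = poly (phi_poly n m lam) (of_nat n / 2) * z ^ n"
proof -
  have "lam i * (of_nat n * z / 2) ^ i * (poly ((pderiv ^^ i) (monom 1 n)) z / fact i)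
      = of_nat (n choose i) * lam i * (of_nat n / 2) ^ i * z ^ n" for i
  proof (cases "i \<le> n")
    case True
    have "(pderiv ^^ i) (monom 1 n) = monom (fact i * of_nat (n choose i) :: complex) (n - i)"
    proof (rule poly_eqI)
      fix j
      have "pochhammer (of_nat (Suc (n - i))) i = fact i * (of_nat (n choose i) :: complex)"
        using True by (simp add: binomial_gbinomial gbinomial_pochhammer' of_nat_diff add.commute)
      then show "coeff ((pderiv ^^ i) (monom 1 n)) j
                   = coeff (monom (fact i * of_nat (n choose i) :: complex) (n - i)) j"
        unfolding coeff_higher_pderiv coeff_monom using True by auto
    qed
    moreover have "z ^ i * z ^ (n - i) = z ^ n"
      using True by (simp flip: power_add)
    ultimately show ?thesis
      by (simp add: poly_monom power_mult_distrib power_divide field_simps)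
  next
    case False
    then have "(pderiv ^^ i) (monom 1 n) = (0 :: complex poly)"
      by (auto intro!: poly_eqI simp: coeff_higher_pderiv)
    then show ?thesis using False by simp
  qed
  then show ?thesis
    by (simp add: poly_N_op phi_poly_def poly_sum poly_monom sum_distrib_right)
qed

context
  assumes m_le_n: "m \<le> n" and n_pos: "1 \<le> n"
    and zeros: "\<And>z. poly (phi_poly n m lam) z = 0 \<Longrightarrow> cmod z \<le> cmod (z - of_nat n / 2)"
begin

lemma phi_poly_half_nonzero: "poly (phi_poly n m lam) (of_nat n / 2) \<noteq> 0"
  using zeros[of "of_nat n / 2"] n_pos by auto

text \<open>For a root \<open>a\<close> of \<open>\<phi>\<close> the condition of \<open>polar_pairing_nonzero\<close> reads \<open>\<bar>a\<bar> < \<bar>z\<bar> \<bar>a - n/2\<bar>\<close>.  It follows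
from the location of the zeros of \<open>\<phi>\<close>, with strict inequality since \<open>\<bar>z\<bar> > 1\<close> and \<open>a \<noteq> n/2\<close>.\<close>

lemma N_op_nonzero_outside:
  assumes "degree H \<le> n" "disc_zero_free (conj_recip n H)" "1 < cmod z"
  shows "poly (N_op n m lam H) z \<noteq> 0"
proof -
  have "polar_pairing n (of_nat n * z / 2) z (phi_poly n m lam) H \<noteq> 0"
  proof (rule polar_pairing_nonzero)
    show "degree (phi_poly n m lam) \<le> n"
      using degree_phi_poly m_le_n by (rule order_trans)
    show "phi_poly n m lam \<noteq> 0"
      using phi_poly_half_nonzero by auto
    fix a assume "poly (phi_poly n m lam) a = 0"
    then have a: "cmod a \<le> cmod (a - of_nat n / 2)" and nz: "a - of_nat n / 2 \<noteq> 0"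
      using zeros[of a] phi_poly_half_nonzero by (simp, metis eq_iff_diff_eq_0)
    have "of_nat n * z / 2 - a * z = - z * (a - of_nat n / 2)"
      by (simp add: algebra_simps)
    then have "cmod (of_nat n * z / 2 - a * z) = cmod z * cmod (a - of_nat n / 2)"
      by (simp only: norm_mult norm_minus_cancel)
    moreover have "1 * cmod (a - of_nat n / 2) < cmod z * cmod (a - of_nat n / 2)"
      using nz assms(3) by (intro mult_strict_right_mono) auto
    ultimately show "cmod a < cmod (of_nat n * z / 2 - a * z)"
      using a by linarith
  qed (use assms in auto)
  then show ?thesis
    unfolding poly_N_op_eq_polar_pairing[OF m_le_n, symmetric] by simp
qed

lemma N_op_conj_recip_nonzero:
  assumes "degree F \<le> n" "disc_zero_free F" "1 < cmod z"
  shows "poly (N_op n m lam (conj_recip n F)) z \<noteq> 0"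
  using N_op_nonzero_outside[OF degree_conj_recip _ assms(3), of F] assms(1,2)
  by (simp add: conj_recip_conj_recip)

text \<open>If the inequality failed, \<open>b = N[F\<^sup>*](z) / N[F](z)\<close> would have modulus below \<open>1\<close>, and
\<open>F\<^sup>* - b F\<close>, the conjugate reciprocal of the zero-free \<open>F - cnj b F\<^sup>*\<close>, would be mapped by \<open>N\<close> to a
polynomial vanishing at \<open>z\<close>.\<close>

lemma N_op_le_conj_recip:
  assumes "degree F \<le> n" "disc_zero_free F" "1 < cmod z"
  shows "cmod (poly (N_op n m lam F) z) \<le> cmod (poly (N_op n m lam (conj_recip n F)) z)"
proof (rule ccontr)
  let ?A = "poly (N_op n m lam F) z" and ?B = "poly (N_op n m lam (conj_recip n F)) z"
  assume *: "\<not> cmod ?A \<le> cmod ?B"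
  then have A: "?A \<noteq> 0" by auto
  define b where "b = ?B / ?A"
  have b: "cmod b < 1"
    using * A by (simp add: b_def norm_divide)
  let ?H = "F - smult (cnj b) (conj_recip n F)"
  have "disc_zero_free ?H"
    unfolding disc_zero_free_def
  proof (intro allI impI notI)
    fix x assume x: "cmod x < 1" and "poly ?H x = 0"
    then have "cmod (poly F x) = cmod b * cmod (poly (conj_recip n F) x)"
      by (metis complex_mod_cnj eq_iff_diff_eq_0 norm_mult poly_diff poly_smult)
    also have "\<dots> \<le> cmod b * cmod (poly F x)"
      using norm_conj_recip_le[OF assms(1,2) x] by (rule mult_left_mono) simp
    finally have "cmod (poly F x) \<le> cmod b * cmod (poly F x)" .
    moreover have "0 < cmod (poly F x)"
      using assms(2) x by (simp add: disc_zero_free_def)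
    ultimately show False
      using b by (simp add: mult_le_cancel_right1)
  qed
  moreover have "degree ?H \<le> n"
    by (intro degree_diff_le assms(1) order_trans[OF degree_smult_le] degree_conj_recip)
  ultimately have "poly (N_op n m lam (conj_recip n ?H)) z \<noteq> 0"
    using N_op_conj_recip_nonzero assms(3) by blast
  then show False
    using A assms(1)
    by (simp add: conj_recip_diff conj_recip_smult conj_recip_conj_recip N_op_diff N_op_smult b_def)
qed

text \<open>For \<open>\<bar>c\<bar> > 1\<close> the polynomial \<open>F = P + c M\<close> has no zeros in the disc by the maximum principle, and
\<open>F\<^sup>* = P\<^sup>* + cnj c M \<psi>\<close>.  Non-vanishing of \<open>N[F\<^sup>*](z)\<close> for all these \<open>c\<close> forces
\<open>\<bar>N[P\<^sup>*](z)\<bar> \<le> M \<bar>N[\<psi>](z)\<bar>\<close>.  This makes it possible to choose the argument of \<open>c\<close> such that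
\<open>\<bar>N[F\<^sup>*](z)\<bar> = \<bar>c\<bar> M \<bar>N[\<psi>](z)\<bar> - \<bar>N[P\<^sup>*](z)\<bar>\<close>, and the comparison \<open>\<bar>N[F]\<bar> \<le> \<bar>N[F\<^sup>*]\<bar>\<close> then has
\<open>\<bar>N[P\<^sup>*]\<bar>\<close> on the useful side.\<close>

lemma N_op_add_conj_recip_le:
  assumes "degree P \<le> n" "circle_max P > 0" "1 < cmod z"
  shows "cmod (poly (N_op n m lam P) z) + cmod (poly (N_op n m lam (conj_recip n P)) z)
           \<le> (cmod (poly (N_op n m lam (monom 1 n)) z) + cmod (lam 0)) * circle_max P"
proof -
  let ?M = "circle_max P"
  let ?A = "poly (N_op n m lam P) z" and ?B = "poly (N_op n m lam (conj_recip n P)) z"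
    and ?C = "poly (N_op n m lam (monom 1 n)) z"
  have shifted: "?B + cnj c * ?M * ?C \<noteq> 0" "cmod (?A + lam 0 * c * ?M) \<le> cmod (?B + cnj c * ?M * ?C)"
    if c: "1 < cmod c" for c
  proof -
    let ?F = "P + [:c * ?M:]"
    have free: "disc_zero_free ?F"
      unfolding disc_zero_free_def
    proof (intro allI impI notI)
      fix x assume "cmod x < 1" "poly ?F x = 0"
      then have "cmod (poly P x) = cmod c * ?M"
        using assms(2) by (simp add: add_eq_0_iff2 norm_mult)
      moreover have "cmod (poly P x) \<le> 1 * ?M"
        using norm_le_circle_max_disc[of x P] \<open>cmod x < 1\<close> by simp
      ultimately show False
        using c assms(2) by simp
    qed
    have deg: "degree ?F \<le> n"
      using assms(1) by (intro degree_add_le) auto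
    have "conj_recip n ?F = conj_recip n P + smult (cnj c * ?M) (monom 1 n)"
      by (simp add: conj_recip_add conj_recip_const smult_monom)
    then have eq: "poly (N_op n m lam (conj_recip n ?F)) z = ?B + cnj c * ?M * ?C"
      by (simp add: N_op_add N_op_smult)
    show "?B + cnj c * ?M * ?C \<noteq> 0"
      using N_op_conj_recip_nonzero[OF deg free assms(3)] eq by simp
    show "cmod (?A + lam 0 * c * ?M) \<le> cmod (?B + cnj c * ?M * ?C)"
      using N_op_le_conj_recip[OF deg free assms(3)] eq
      by (simp add: N_op_add poly_N_op_const mult_ac)
  qed
  have C: "?C \<noteq> 0"
    using phi_poly_half_nonzero assms(3) by (auto simp: poly_N_op_power)
  have B: "cmod ?B \<le> ?M * cmod ?C"
  proof (rule ccontr)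
    assume *: "\<not> cmod ?B \<le> ?M * cmod ?C"
    define c where "c = cnj (- ?B / (?M * ?C))"
    have "1 < cmod c"
      using * C assms(2) by (simp add: c_def norm_divide norm_mult)
    moreover have "?B + cnj c * ?M * ?C = 0"
      using C assms(2) by (simp add: c_def)
    ultimately show False using shifted(1) by blast
  qed
  have bound: "cmod ?A + cmod ?B \<le> r * ((cmod ?C + cmod (lam 0)) * ?M)" if r: "1 < r" for r
  proof -
    define e where "e = (if ?B = 0 then 1 else sgn ?B)"
    have e: "cmod e = 1"
      by (simp add: e_def norm_sgn)
    have Be: "?B = cmod ?B * e"
      by (simp add: e_def sgn_div_norm scaleR_conv_of_real)
    \<comment> \<open>This \<open>c\<close> makes \<open>cnj c M N[\<psi>](z)\<close> point in the direction opposite to \<open>N[P\<^sup>*](z)\<close>.\<close>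
    define c where "c = cnj (- r * e * cmod ?C / ?C)"
    have c: "cmod c = r"
      using C e r by (simp add: c_def norm_divide norm_mult)
    have "?B + cnj c * ?M * ?C = (cmod ?B - r * cmod ?C * ?M) * e"
      using C by (subst (1) Be) (simp add: c_def field_simps)
    then have "cmod (?B + cnj c * ?M * ?C) = \<bar>cmod ?B - r * cmod ?C * ?M\<bar>"
      using e by (metis mult.right_neutral norm_mult norm_of_real of_real_diff of_real_mult)
    also have "\<dots> = r * cmod ?C * ?M - cmod ?B"
    proof -
      have "1 * (?M * cmod ?C) \<le> r * (?M * cmod ?C)"
        using r assms(2) by (intro mult_right_mono) auto
      with B show ?thesis by (simp add: mult_ac)
    qed
    finally have "cmod (?A + lam 0 * c * ?M) \<le> r * cmod ?C * ?M - cmod ?B"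
      using shifted(2)[of c] c r by simp
    moreover have "cmod ?A - cmod (lam 0 * c * ?M) \<le> cmod (?A + lam 0 * c * ?M)"
      by (rule norm_diff_ineq)
    moreover have "cmod (lam 0 * c * ?M) = r * cmod (lam 0) * ?M"
      using c assms(2) by (simp add: norm_mult)
    ultimately show ?thesis
      by (simp add: algebra_simps)
  qed
  show ?thesis
  proof (rule tendsto_lowerbound[where F = "at_right 1"])
    show "((\<lambda>r::real. r * ((cmod ?C + cmod (lam 0)) * ?M)) \<longlongrightarrow> (cmod ?C + cmod (lam 0)) * ?M) (at_right 1)"
      by (rule tendsto_eq_intros refl)+ simp
    show "\<forall>\<^sub>F r in at_right 1. cmod ?A + cmod ?B \<le> r * ((cmod ?C + cmod (lam 0)) * ?M)"
      using bound by (auto simp: eventually_at_right_field intro: exI[of _ 2])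
  qed simp
qed

lemma N_op_bound_outside:
  assumes "degree P \<le> n" "disc_zero_free P" "1 \<le> cmod z"
  shows "cmod (poly (N_op n m lam P) z)
           \<le> 1 / 2 * (cmod (poly (N_op n m lam (monom 1 n)) z) + cmod (lam 0)) * circle_max P"
    (is "?f z \<le> ?g z")
proof -
  have "0 < cmod (poly P 0)"
    using assms(2) by (simp add: disc_zero_free_def)
  also have "\<dots> \<le> circle_max P"
    by (rule norm_le_circle_max_disc) simp
  finally have M: "0 < circle_max P" .
  have strict: "?f w \<le> ?g w" if "1 < cmod w" for w
    using N_op_le_conj_recip[OF assms(1,2) that] N_op_add_conj_recip_le[OF assms(1) M that]
    by simp
  show ?thesis
  proof (rule tendsto_le[where F = "at_right (1::real)"])
    show "((\<lambda>t. ?f (of_real t * z)) \<longlongrightarrow> ?f z) (at_right 1)"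
      by (rule tendsto_eq_intros refl)+ simp
    show "((\<lambda>t. ?g (of_real t * z)) \<longlongrightarrow> ?g z) (at_right 1)"
      by (rule tendsto_eq_intros refl)+ simp
    have "?f (of_real t * z) \<le> ?g (of_real t * z)" if "1 < t" for t :: real
    proof (rule strict)
      have "1 < t * 1" using that by simp
      also have "\<dots> \<le> t * cmod z" using that assms(3) by (intro mult_left_mono) auto
      finally show "1 < cmod (of_real t * z)" using that by (simp add: norm_mult)
    qed
    then show "\<forall>\<^sub>F t in at_right 1. ?f (of_real t * z) \<le> ?g (of_real t * z)"
      by (auto simp: eventually_at_right_field intro: exI[of _ 2])
  qed simp
qed

end
end

section \<open>Sharpness and the final inequality\<close>

lemma exists_power_align:
  fixes u v :: complex
  assumes "1 \<le> n"
  obtains z where "cmod z = 1" "cmod (u * z ^ n + v) = cmod u + cmod v"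
proof (cases "u = 0 \<or> v = 0")
  case True
  then show thesis using that[of 1] by auto
next
  case False
  let ?w = "sgn v / sgn u"
  have w: "?w \<noteq> 0" "cmod ?w = 1"
    using False by (auto simp: norm_divide norm_sgn sgn_zero_iff)
  obtain z where z: "z ^ n = ?w"
  proof
    show "exp (Ln ?w / of_nat n) ^ n = ?w"
      using assms w(1) by (simp flip: exp_of_nat_mult)
  qed
  then have "cmod z ^ n = 1 ^ n"
    using w by (metis norm_power power_one)
  then have "cmod z = 1"
    using assms by (metis norm_ge_zero power_eq_imp_eq_base zero_le_one zero_less_one less_le_trans)
  moreover have "u * z ^ n + v = of_real (cmod u + cmod v) * sgn v"
    using False unfolding z by (simp add: sgn_div_norm scaleR_conv_of_real field_simps)
  ultimately show thesis
    using that[of z] False by (simp add: norm_mult norm_sgn del: of_real_add)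
qed

lemma circle_max_binomial:
  assumes "1 \<le> n"
  shows "circle_max (monom a n + [:b:]) = cmod a + cmod b"
proof (rule antisym)
  obtain z where "cmod z = 1" "cmod (a * z ^ n + b) = cmod a + cmod b"
    using exists_power_align[OF assms] .
  then show "cmod a + cmod b \<le> circle_max (monom a n + [:b:])"
    using circle_max_attained(2)[of z "monom a n + [:b:]"] by (simp add: poly_monom)
  obtain w where "cmod w = 1" "cmod (poly (monom a n + [:b:]) w) = circle_max (monom a n + [:b:])"
    using circle_max_attained(1) by blast
  then show "circle_max (monom a n + [:b:]) \<le> cmod a + cmod b"
    using norm_triangle_ineq[of "a * w ^ n" b] by (simp add: poly_monom norm_mult norm_power)
qed

theorem theorem1p3:
  fixes n m :: nat and lam :: "nat \<Rightarrow> complex"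
  assumes "m \<le> n" and "1 \<le> n"
    and "\<And>z. poly (phi_poly n m lam) z = 0 \<Longrightarrow> cmod z \<le> cmod (z - of_nat n / 2)"
  shows "(\<forall>P \<in> poly_class n. (\<forall>z. cmod z < 1 \<longrightarrow> poly P z \<noteq> 0) \<longrightarrow>
            (\<forall>z. 1 \<le> cmod z \<longrightarrow>
               cmod (poly (N_op n m lam P) z)
                 \<le> 1 / 2 * (cmod (poly (N_op n m lam (monom 1 n)) z) + cmod (lam 0)) * circle_max P))
       \<and> (\<forall>a b P. cmod a = cmod b \<and> cmod b \<noteq> 0 \<and> P = monom a n + [:b:] \<longrightarrow>
            (\<exists>z. 1 \<le> cmod z \<and>
               cmod (poly (N_op n m lam P) z)
                 = 1 / 2 * (cmod (poly (N_op n m lam (monom 1 n)) z) + cmod (lam 0)) * circle_max P))"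
proof (intro conjI ballI allI impI)
  fix P z assume "P \<in> poly_class n" "\<forall>z. cmod z < 1 \<longrightarrow> poly P z \<noteq> 0" "1 \<le> cmod z"
  then show "cmod (poly (N_op n m lam P) z)
      \<le> 1 / 2 * (cmod (poly (N_op n m lam (monom 1 n)) z) + cmod (lam 0)) * circle_max P"
    by (intro N_op_bound_outside[OF assms]) (simp_all add: poly_class_def disc_zero_free_def)
next
  fix a b P assume ab: "cmod a = cmod b \<and> cmod b \<noteq> 0 \<and> P = monom a n + [:b:]"
  let ?c = "poly (phi_poly n m lam) (of_nat n / 2)"
  obtain z where z: "cmod z = 1" "cmod (a * ?c * z ^ n + b * lam 0) = cmod (a * ?c) + cmod (b * lam 0)"
    using exists_power_align[OF assms(2)] .
  have "N_op n m lam P = smult a (N_op n m lam (monom 1 n)) + N_op n m lam [:b:]"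
    using ab by (simp add: N_op_add smult_monom flip: N_op_smult)
  then have "poly (N_op n m lam P) z = a * ?c * z ^ n + b * lam 0"
    by (simp add: poly_N_op_const poly_N_op_power)
  moreover have "cmod (poly (N_op n m lam (monom 1 n)) z) = cmod ?c"
    using z(1) by (simp add: poly_N_op_power norm_mult norm_power)
  moreover have "circle_max P = 2 * cmod b"
    using ab circle_max_binomial[OF assms(2), of a b] by simp
  ultimately have "cmod (poly (N_op n m lam P) z)
      = 1 / 2 * (cmod (poly (N_op n m lam (monom 1 n)) z) + cmod (lam 0)) * circle_max P"
    using z(2) ab by (simp add: norm_mult algebra_simps)
  then show "\<exists>z. 1 \<le> cmod z \<and> cmod (poly (N_op n m lam P) z)
      = 1 / 2 * (cmod (poly (N_op n m lam (monom 1 n)) z) + cmod (lam 0)) * circle_max P"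
    using z(1) by (intro exI[of _ z]) simp
qed

end
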